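(* If $G$ is a graph with maximum degree $\Delta(G)=3$, then $3\le \chi_2^f(G)\le 5$.
   Context: All graphs are finite and simple. A $2$-frugal coloring of $G$ is a proper vertex coloring in which no color appears more than twice in the (open) neighborhood of any vertex; $\chi_2^f(G)$ is the minimum number of colors in a $2$-frugal coloring of $G$. *)

theory Defs
  imports "Graph_Theory.Digraph"
begin

text \<open>
  Finite simple graphs are modelled by the locale \<^locale>\<open>graph\<close>: finite, loop-free, symmetric
  digraphs without multiple arcs, an undirected edge being a pair of opposite arcs.
\<close>

definition nbhd :: "('a, 'b) pre_digraph \<Rightarrow> 'a \<Rightarrow> 'a set" where
  "nbhd G v = {u. v \<rightarrow>\<^bsub>G\<^esub> u}"

text \<open>
  As every undirected edge contributes exactly one arc leaving each of its ends, the degree of a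
  vertex is its \<^const>\<open>out_degree\<close>. \<^const>\<open>Sup\<close> is used rather than \<^const>\<open>Max\<close> because
  the latter is unspecified on the graph without vertices, whereas \<^prop>\<open>Sup {} = (0::nat)\<close>.
\<close>

definition max_degree :: "('a, 'b) pre_digraph \<Rightarrow> nat" where
  "max_degree G = (SUP v\<in>verts G. out_degree G v)"

definition proper_coloring :: "('a, 'b) pre_digraph \<Rightarrow> ('a \<Rightarrow> 'c) \<Rightarrow> bool" where
  "proper_coloring G c \<longleftrightarrow> (\<forall>u v. u \<rightarrow>\<^bsub>G\<^esub> v \<longrightarrow> c u \<noteq> c v)"

definition frugal_coloring :: "nat \<Rightarrow> ('a, 'b) pre_digraph \<Rightarrow> ('a \<Rightarrow> 'c) \<Rightarrow> bool" where
  "frugal_coloring t G c \<longleftrightarrow>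
     proper_coloring G c \<and> (\<forall>v\<in>verts G. \<forall>i. card {u \<in> nbhd G v. c u = i} \<le> t)"

definition frugal_chromatic_number :: "nat \<Rightarrow> ('a, 'b) pre_digraph \<Rightarrow> nat" where
  "frugal_chromatic_number t G =
     (LEAST k. \<exists>c :: 'a \<Rightarrow> nat. frugal_coloring t G c \<and> card (c ` verts G) = k)"

text \<open>
  The minimum is attained for \<open>t \<ge> 1\<close>, since an injective coloring of the vertices is \<open>t\<close>-frugal.
\<close>

lemma (in graph) frugal_chromatic_number_attained:
  assumes "t \<ge> 1"
  shows "\<exists>c :: 'a \<Rightarrow> nat. frugal_coloring t G c \<and> card (c ` verts G) = frugal_chromatic_number t G"
proof -
  obtain c :: "'a \<Rightarrow> nat" where inj: "inj_on c (verts G)"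
    using finite_imp_inj_to_nat_seg[OF finite_verts] by blast
  have V: "u \<in> verts G" "v \<in> verts G" "u \<noteq> v" if "u \<rightarrow> v" for u v
    using that adj_not_same by (auto simp: arcs_ends_conv)
  have "proper_coloring G c"
    unfolding proper_coloring_def using V inj by (metis inj_onD)
  moreover have "card {u \<in> nbhd G v. c u = i} \<le> t" for v i
  proof -
    have "is_singleton {u \<in> nbhd G v. c u = i} \<or> {u \<in> nbhd G v. c u = i} = {}"
      using V inj unfolding nbhd_def is_singleton_def inj_on_def by blast
    then show ?thesis
      using assms by (metis card.empty is_singleton_altdef zero_le)
  qed
  ultimately have "\<exists>k. \<exists>c :: 'a \<Rightarrow> nat. frugal_coloring t G c \<and> card (c ` verts G) = k"
    unfolding frugal_coloring_def by blast
  then show ?thesis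
    unfolding frugal_chromatic_number_def by (rule LeastI_ex)
qed

end

theory Submission
  imports Defs
begin

text \<open>
  The lower bound is local: the neighbourhood of a vertex of degree \<open>3\<close> needs two colours, and the
  vertex itself a third (\<open>two_frugal_lower\<close>).

  For the upper bound, let \<open>A\<close> be maximal among the independent sets that meet every neighbourhood
  in at most two vertices. The set \<open>A\<close> receives a colour of its own, and what remains is to colour the
  other vertices with four colours. A neighbourhood of three vertices that meets \<open>A\<close>
  also meets the complement of \<open>A\<close>, so it has two colours. Hence only the neighbourhoods of the
  vertices in \<open>A\<close> and of the vertices that are neither in \<open>A\<close> nor adjacent to \<open>A\<close> (the undominated
  ones) matter. For each such vertex \<open>u\<close> one
  of its neighbours is omitted and the other two are required to get different colours. These
  requirements and the edges of the graph form a conflict graph on the complement of \<open>A\<close>, and it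
  suffices to choose the omitted neighbours such that every nonempty set \<open>D\<close> of vertices contains one
  with at most three conflicts inside \<open>D\<close>: then greedy colouring needs only four colours
  (\<open>degenerate_coloring\<close>, \<open>conflict_degenerate\<close>).

  A neighbour \<open>u\<close> of \<open>b\<close> causes at most one conflict at \<open>b\<close>, unless \<open>u\<close> is undominated and does not
  omit \<open>b\<close>, when it can cause two. Maximality of \<open>A\<close> gives every undominated vertex \<open>u\<close> a blocker, a
  neighbour with two neighbours in \<open>A\<close>, and \<open>u\<close> is the only undominated neighbour of its blocker. If
  every undominated \<open>u\<close> omits its blocker, then a set \<open>D\<close> in which all vertices have at least four
  conflicts can only be a union of cycles of undominated vertices. These cycles lie in the
  core below. To destroy them, the members of a maximal set \<open>S\<close> of core vertices at pairwise distance
  at least three omit another neighbour than the blocker. Since the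
  members of \<open>S\<close> are far apart, their exceptional choices do not interact, and since \<open>S\<close> is maximal, no
  cycle avoids them.
\<close>

section \<open>Colouring degenerate relations\<close>

lemma degenerate_coloring:
  fixes R :: "'a \<Rightarrow> 'a \<Rightarrow> bool"
  assumes "finite B"
    and sym: "\<And>x y. R x y \<Longrightarrow> R y x"
    and irrefl: "\<And>x. \<not> R x x"
    and deg: "\<And>D. D \<subseteq> B \<Longrightarrow> D \<noteq> {} \<Longrightarrow> \<exists>b\<in>D. card {x \<in> D. R b x} < n"
  shows "\<exists>g :: 'a \<Rightarrow> nat. (\<forall>x\<in>B. g x < n) \<and> (\<forall>x\<in>B. \<forall>y\<in>B. R x y \<longrightarrow> g x \<noteq> g y)"
  using assms(1) deg
proof (induction B rule: finite_psubset_induct)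
  case (psubset B)
  show ?case
  proof (cases "B = {}")
    case False
    then obtain b where b: "b \<in> B" "card {x \<in> B. R b x} < n"
      using psubset.prems by blast
    have "\<exists>x\<in>D. card {y \<in> D. R x y} < n" if "D \<subseteq> B - {b}" "D \<noteq> {}" for D
      using psubset.prems[of D] that by blast
    moreover have "B - {b} \<subset> B"
      using b by blast
    ultimately have "\<exists>g :: 'a \<Rightarrow> nat. (\<forall>x\<in>B - {b}. g x < n) \<and>
        (\<forall>x\<in>B - {b}. \<forall>y\<in>B - {b}. R x y \<longrightarrow> g x \<noteq> g y)"
      by (intro psubset.IH)
    then obtain g :: "'a \<Rightarrow> nat" where g: "\<forall>x\<in>B - {b}. g x < n"
        "\<forall>x\<in>B - {b}. \<forall>y\<in>B - {b}. R x y \<longrightarrow> g x \<noteq> g y"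
      by (elim exE conjE)
    have "card (g ` {x \<in> B. R b x}) < card {..<n}"
      using b card_image_le[of "{x \<in> B. R b x}" g] psubset.hyps by simp
    then have "\<not> {..<n} \<subseteq> g ` {x \<in> B. R b x}"
      using psubset.hyps card_mono[of "g ` {x \<in> B. R b x}" "{..<n}"] by fastforce
    then obtain i where i: "i < n" "i \<notin> g ` {x \<in> B. R b x}"
      by auto
    have "\<forall>x\<in>B. (g(b := i)) x < n"
      using g(1) i(1) by simp
    moreover have "\<forall>x\<in>B. \<forall>y\<in>B. R x y \<longrightarrow> (g(b := i)) x \<noteq> (g(b := i)) y"
    proof (intro ballI impI)
      fix x y
      assume xy: "x \<in> B" "y \<in> B" "R x y"
      then have "R y x" "x \<noteq> y"
        using sym irrefl by blast+
      then show "(g(b := i)) x \<noteq> (g(b := i)) y"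
        using xy g(2) i(2) by auto
    qed
    ultimately show ?thesis
      by blast
  qed simp
qed

lemma finite_maximal_subset:
  assumes "finite V" "X \<subseteq> V" "P X"
  shows "\<exists>M\<subseteq>V. P M \<and> (\<forall>Y\<subseteq>V. P Y \<longrightarrow> M \<subseteq> Y \<longrightarrow> Y = M)"
proof -
  have "finite {Y. Y \<subseteq> V \<and> P Y}"
    using assms(1) by simp
  moreover have "X \<in> {Y. Y \<subseteq> V \<and> P Y}"
    using assms by simp
  ultimately obtain M where "M \<in> {Y. Y \<subseteq> V \<and> P Y}"
      "\<forall>Y\<in>{Y. Y \<subseteq> V \<and> P Y}. M \<subseteq> Y \<longrightarrow> M = Y"
    using finite_has_maximal2[of "{Y. Y \<subseteq> V \<and> P Y}" X] by blast
  then show ?thesis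
    by (intro exI[of _ M]) auto
qed

section \<open>A sparse first colour class\<close>

locale subcubic =
  fixes V :: "'a set" and N :: "'a \<Rightarrow> 'a set"
  assumes finite_V: "finite V"
    and N_subset: "N v \<subseteq> V"
    and N_sym: "u \<in> N v \<Longrightarrow> v \<in> N u"
    and N_irrefl: "v \<notin> N v"
    and N_card: "card (N v) \<le> 3"
begin

lemma finite_N [simp]: "finite (N v)"
  by (rule finite_subset[OF N_subset finite_V])

text \<open>
  These are exactly the vertex sets that can occur as a colour class of a 2-frugal colouring.
\<close>

definition sparse :: "'a set \<Rightarrow> bool" where
  "sparse A \<longleftrightarrow> (\<forall>a\<in>A. N a \<inter> A = {}) \<and> (\<forall>v. card (N v \<inter> A) \<le> 2)"

text \<open>For distinct vertices this says that their distance is at least three.\<close>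

definition far :: "'a \<Rightarrow> 'a \<Rightarrow> bool" where
  "far s t \<longleftrightarrow> t \<notin> N s \<and> N s \<inter> N t = {}"

lemma far_sym: "far s t \<Longrightarrow> far t s"
  unfolding far_def by (metis N_sym Int_commute)

end

locale maximal_sparse = subcubic +
  fixes A :: "'a set"
  assumes A_subset: "A \<subseteq> V"
    and A_sparse: "sparse A"
    and A_maximal: "Y \<subseteq> V \<Longrightarrow> sparse Y \<Longrightarrow> A \<subseteq> Y \<Longrightarrow> Y = A"
begin

definition undominated :: "'a set" where
  "undominated = {v \<in> V - A. N v \<inter> A = {}}"

definition blocker :: "'a \<Rightarrow> 'a" where
  "blocker u = (SOME w. w \<in> N u \<and> card (N w \<inter> A) = 2)"

lemma A_independent: "a \<in> A \<Longrightarrow> N a \<inter> A = {}"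
  and A_two: "card (N v \<inter> A) \<le> 2"
  using A_sparse unfolding sparse_def by auto

text \<open>
  By maximality of \<^term>\<open>A\<close>, the only thing that keeps an undominated vertex out of \<^term>\<open>A\<close> is a
  neighbour that already has two neighbours in \<^term>\<open>A\<close>.
\<close>

lemma blocker:
  assumes "u \<in> undominated"
  shows "blocker u \<in> N u" "card (N (blocker u) \<inter> A) = 2"
proof -
  have u: "u \<in> V" "u \<notin> A" "N u \<inter> A = {}"
    using assms unfolding undominated_def by auto
  have "\<not> sparse (insert u A)"
    using A_maximal[of "insert u A"] u A_subset by blast
  moreover have "N a \<inter> insert u A = {}" if "a \<in> insert u A" for a
    using that u A_independent N_irrefl N_sym by blast
  ultimately obtain w where w: "card (N w \<inter> insert u A) > 2"
    unfolding sparse_def by (metis not_le)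
  have "u \<in> N w"
  proof (rule ccontr)
    assume "u \<notin> N w"
    then have "N w \<inter> insert u A = N w \<inter> A"
      by blast
    then show False
      using w A_two[of w] by simp
  qed
  moreover have "card (N w \<inter> insert u A) \<le> Suc (card (N w \<inter> A))"
    using \<open>u \<in> N w\<close> by (simp add: card_insert_if)
  then have "card (N w \<inter> A) = 2"
    using w A_two[of w] by simp
  ultimately have "\<exists>w. w \<in> N u \<and> card (N w \<inter> A) = 2"
    using N_sym by blast
  from someI_ex[OF this] show "blocker u \<in> N u" "card (N (blocker u) \<inter> A) = 2"
    unfolding blocker_def by auto
qed

lemma blocker_notin:
  assumes "u \<in> undominated"
  shows "blocker u \<notin> A" "blocker u \<notin> undominated"
proof -
  have "N (blocker u) \<inter> A \<noteq> {}"
    using blocker(2)[OF assms] by auto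
  then show "blocker u \<notin> A" "blocker u \<notin> undominated"
    using A_independent unfolding undominated_def by auto
qed

text \<open>
  Two of the at most three neighbours of a blocker lie in \<^term>\<open>A\<close>, so it blocks only one vertex.
\<close>

lemma blocker_unique:
  assumes "u \<in> undominated" "t \<in> undominated" "t \<in> N (blocker u)"
  shows "t = u"
proof (rule ccontr)
  assume "t \<noteq> u"
  let ?w = "blocker u"
  have "u \<in> N ?w" "u \<notin> A" "t \<notin> A"
    using blocker(1)[OF assms(1)] N_sym assms unfolding undominated_def by auto
  then have "card (insert u (insert t (N ?w \<inter> A))) = 4"
    using \<open>t \<noteq> u\<close> blocker(2)[OF assms(1)] by simp
  moreover have "card (insert u (insert t (N ?w \<inter> A))) \<le> card (N ?w)"
    using \<open>u \<in> N ?w\<close> assms(3) by (intro card_mono) auto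
  ultimately show False
    using N_card[of ?w] by simp
qed

text \<open>
  As the blocker of an undominated vertex is dominated, the undominated vertices induce a graph of
  maximum degree at most two, a disjoint union of paths and cycles. The core consists of the
  components of this graph that have an edge and whose vertices have no dominated neighbour except
  their blockers; in particular, it contains the cycles.
\<close>

definition core :: "'a set" where
  "core = \<Union>{X. X \<subseteq> undominated \<and> (\<forall>b\<in>X. N b - {blocker b} \<subseteq> X \<and> N b - {blocker b} \<noteq> {})}"

lemma core_subset: "core \<subseteq> undominated"
  and core_closed: "b \<in> core \<Longrightarrow> N b - {blocker b} \<subseteq> core"
  and core_nonempty: "b \<in> core \<Longrightarrow> N b - {blocker b} \<noteq> {}"
  unfolding core_def by blast+

lemma core_greatest:
  assumes "X \<subseteq> undominated"
    and "\<And>b. b \<in> X \<Longrightarrow> N b - {blocker b} \<subseteq> X \<and> N b - {blocker b} \<noteq> {}"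
  shows "X \<subseteq> core"
  using assms unfolding core_def by blast

end

section \<open>The conflict graph on the other vertices\<close>

locale scattered_core = maximal_sparse +
  fixes S :: "'a set"
  assumes S_core: "S \<subseteq> core"
    and S_far: "s \<in> S \<Longrightarrow> t \<in> S \<Longrightarrow> s \<noteq> t \<Longrightarrow> far s t"
    and S_maximal: "b \<in> core \<Longrightarrow> b \<notin> S \<Longrightarrow> \<exists>t\<in>S. \<not> far b t"
begin

text \<open>
  If \<open>u\<close> is in \<^term>\<open>A\<close> or undominated, its at most two neighbours other than \<open>omitted u\<close> are to get
  different colours. For \<open>u\<close> in \<^term>\<open>A\<close> every choice will do.
\<close>

definition omitted :: "'a \<Rightarrow> 'a" where
  "omitted u =
     (if u \<in> S then SOME y. y \<in> N u - {blocker u}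
      else if u \<in> undominated then blocker u
      else SOME y. y \<in> N u)"

definition partners :: "'a \<Rightarrow> 'a \<Rightarrow> 'a set" where
  "partners u b =
     (if u \<in> A \<union> undominated \<and> omitted u \<noteq> b then N u - {omitted u, b} else {})"

definition conflict :: "'a \<Rightarrow> 'a \<Rightarrow> bool" where
  "conflict b x \<longleftrightarrow> x \<in> N b \<or> (\<exists>u\<in>N b. x \<in> partners u b)"

text \<open>The conflicts of \<open>b\<close> inside \<open>D\<close> that are due to its neighbour \<open>u\<close>.\<close>

definition load :: "'a set \<Rightarrow> 'a \<Rightarrow> 'a \<Rightarrow> nat" where
  "load D b u = card (insert u (partners u b) \<inter> D)"

lemma partners_sym:
  assumes "u \<in> N b" "x \<in> partners u b"
  shows "u \<in> N x" "b \<in> partners u x"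
proof -
  have "u \<in> A \<union> undominated" "omitted u \<noteq> b" "x \<in> N u" "x \<noteq> omitted u" "x \<noteq> b"
    using assms(2) unfolding partners_def by (auto split: if_splits)
  moreover have "b \<in> N u"
    using assms(1) by (rule N_sym)
  ultimately show "u \<in> N x" "b \<in> partners u x"
    unfolding partners_def by (auto intro: N_sym[of x u])
qed

lemma conflict_sym: "conflict b x \<Longrightarrow> conflict x b"
  unfolding conflict_def using partners_sym by (metis N_sym)

lemma conflict_irrefl: "\<not> conflict b b"
  unfolding conflict_def partners_def using N_irrefl by auto

lemma omitted_special:
  assumes "s \<in> S"
  shows "omitted s \<in> N s - {blocker s}"
proof -
  have "\<exists>y. y \<in> N s - {blocker s}"
    using assms S_core core_nonempty by blast
  from someI_ex[OF this] show ?thesis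
    using assms unfolding omitted_def by simp
qed

lemma omitted_undominated: "u \<in> undominated \<Longrightarrow> u \<notin> S \<Longrightarrow> omitted u = blocker u"
  unfolding omitted_def by simp

lemma omitted_in:
  assumes "N u \<noteq> {}"
  shows "omitted u \<in> N u"
proof (cases "u \<in> S")
  case True
  then show ?thesis
    using omitted_special by blast
next
  case False
  then show ?thesis
    using assms blocker(1)[of u] by (simp add: omitted_def some_in_eq)
qed

lemma finite_partners [simp]: "finite (partners u b)"
  unfolding partners_def by simp

lemma card_partners:
  assumes "u \<in> N b"
  shows "card (partners u b) \<le> 1"
proof (cases "omitted u = b")
  case False
  have "b \<in> N u"
    using assms N_sym by blast
  then have "{omitted u, b} \<subseteq> N u"
    using omitted_in[of u] by auto
  then have "card (N u - {omitted u, b}) \<le> 1"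
    using False N_card[of u] by (simp add: card_Diff_subset)
  then show ?thesis
    unfolding partners_def by simp
qed (simp add: partners_def)

lemma load_le:
  assumes "u \<in> N b"
  shows "load D b u \<le> (if u \<in> D then 1 else 0) + card (partners u b \<inter> D)"
proof -
  have "insert u (partners u b) \<inter> D \<subseteq> (if u \<in> D then {u} else {}) \<union> (partners u b \<inter> D)"
    by auto
  then have "load D b u \<le> card ((if u \<in> D then {u} else {}) \<union> (partners u b \<inter> D))"
    unfolding load_def by (intro card_mono) auto
  also have "\<dots> \<le> card (if u \<in> D then {u} else {}) + card (partners u b \<inter> D)"
    by (rule card_Un_le)
  finally show ?thesis
    by (simp split: if_splits)
qed

lemma card_partners_Int:
  assumes "u \<in> N b"
  shows "card (partners u b \<inter> D) \<le> 1"
  using card_partners[OF assms] card_mono[of "partners u b" "partners u b \<inter> D"] by simp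

lemma load_le_2: "u \<in> N b \<Longrightarrow> load D b u \<le> 2"
  using load_le[of u b D] card_partners_Int[of u b D] by (simp split: if_splits)

text \<open>
  A neighbour in \<^term>\<open>A\<close> is not itself in conflict with \<open>b\<close>, and a dominated neighbour outside \<^term>\<open>A\<close>
  imposes nothing on its neighbourhood; hence only undominated neighbours have load two.
\<close>

lemma load_gt_1:
  assumes "D \<subseteq> V - A" "u \<in> N b" "1 < load D b u"
  shows "u \<in> D \<inter> undominated" "omitted u \<noteq> b"
proof -
  have u: "u \<in> D" "partners u b \<noteq> {}"
    using load_le[OF assms(2), of D] card_partners_Int[OF assms(2), of D] assms(3)
    by (auto split: if_splits)
  then show "u \<in> D \<inter> undominated" "omitted u \<noteq> b"
    using assms(1) unfolding partners_def by (auto split: if_splits)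
qed

lemma conflict_degree_le:
  assumes "D \<subseteq> V - A"
  shows "card {x \<in> D. conflict b x} \<le> (\<Sum>u\<in>N b. load D b u)"
proof -
  have "{x \<in> D. conflict b x} = (\<Union>u\<in>N b. insert u (partners u b) \<inter> D)"
    unfolding conflict_def by auto
  also have "card \<dots> \<le> (\<Sum>u\<in>N b. load D b u)"
    unfolding load_def by (rule card_UN_le) simp
  finally show ?thesis .
qed

text \<open>
  Suppose that all vertices of \<^term>\<open>D\<close> have at least four conflicts in \<^term>\<open>D\<close>. Having at most three
  neighbours, each of them has a neighbour of load two. For the blocker of a vertex \<open>b\<close> outside
  \<^term>\<open>S\<close> this neighbour could only be \<open>b\<close>, which omits it; so the blocker is not in \<^term>\<open>D\<close>, and both
  other neighbours of \<open>b\<close> must have load two, hence are undominated and in \<^term>\<open>D\<close>. Thus \<^term>\<open>D\<close> is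
  closed under passing to the non-blocking neighbours, except perhaps at the members of \<^term>\<open>S\<close>. A
  member \<open>s\<close> of \<^term>\<open>S\<close> gets load at most one from its blocker, at most two from one further
  neighbour and none at all from the one that it omits, so \<^term>\<open>D\<close> avoids \<^term>\<open>S\<close>. But then closure
  puts the undominated part of \<^term>\<open>D\<close> into the core, where every vertex is within distance two of
  \<^term>\<open>S\<close>, and leads from there into \<^term>\<open>S\<close>.
\<close>

lemma conflict_degenerate:
  assumes D: "D \<subseteq> V - A" and "D \<noteq> {}"
  shows "\<exists>b\<in>D. card {x \<in> D. conflict b x} < 4"
proof (rule ccontr)
  assume "\<not> ?thesis"
  then have heavy: "4 \<le> (\<Sum>u\<in>N b. load D b u)" if "b \<in> D" for b
    using that conflict_degree_le[OF D, of b] by force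
  have double: "\<exists>u\<in>N b. u \<in> D \<inter> undominated \<and> omitted u \<noteq> b" if "b \<in> D" for b
  proof (rule ccontr)
    assume "\<not> ?thesis"
    then have "load D b u \<le> 1" if "u \<in> N b" for u
      using load_gt_1[OF D that] that by force
    then have "(\<Sum>u\<in>N b. load D b u) \<le> card (N b)"
      using sum_bounded_above[of "N b" "load D b" 1] by simp
    then show False
      using heavy[OF that] N_card[of b] by simp
  qed
  have blocker_load: "load D b (blocker b) \<le> (if blocker b \<in> D then 1 else 0)"
    if "b \<in> undominated" for b
    using load_le[OF blocker(1)[OF that], of D] blocker_notin[OF that]
    by (simp add: partners_def)
  have split: "(\<Sum>u\<in>N b. load D b u) = load D b (blocker b) + (\<Sum>u\<in>N b - {blocker b}. load D b u)"
    and rest: "card (N b - {blocker b}) \<le> 2"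
    if "b \<in> undominated" for b
    using blocker(1)[OF that] N_card[of b] by (simp_all add: sum.remove)
  \<comment> \<open>Closure of \<open>D\<close> at the vertices outside \<open>S\<close>.\<close>
  have ordinary: "N b - {blocker b} \<noteq> {} \<and>
      (\<forall>u\<in>N b - {blocker b}. u \<in> D \<inter> undominated \<and> omitted u \<noteq> b)"
    if "b \<in> D" "b \<in> undominated" "b \<notin> S" for b
  proof -
    have "blocker b \<notin> D"
      using double[of "blocker b"] blocker_unique[OF that(2)] omitted_undominated[OF that(2,3)]
      by fastforce
    then have sum4: "4 \<le> (\<Sum>u\<in>N b - {blocker b}. load D b u)"
      using heavy[OF that(1)] split[OF that(2)] blocker_load[OF that(2)] by simp
    have "1 < load D b u" if u: "u \<in> N b - {blocker b}" for u
    proof -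
      have "(\<Sum>u\<in>N b - {blocker b}. load D b u) =
          load D b u + (\<Sum>u\<in>N b - {blocker b} - {u}. load D b u)"
        using u by (simp add: sum.remove)
      moreover have "(\<Sum>u\<in>N b - {blocker b} - {u}. load D b u) \<le> card (N b - {blocker b} - {u}) * 2"
        using sum_bounded_above[of "N b - {blocker b} - {u}" "load D b" 2] load_le_2 by simp
      moreover have "card (N b - {blocker b} - {u}) \<le> 1"
        using rest[OF \<open>b \<in> undominated\<close>] u by simp
      ultimately show ?thesis
        using sum4 by linarith
    qed
    then show ?thesis
      using load_gt_1[OF D] sum4 by fastforce
  qed
  have no_special: "s \<notin> D" if s: "s \<in> S" for s
  proof
    assume "s \<in> D"
    define y where "y = omitted s"
    have s': "s \<in> undominated" "s \<in> core"
      using s S_core core_subset by auto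
    have y: "y \<in> N s - {blocker s}" "y \<in> core" "y \<in> undominated"
      using omitted_special[OF s] core_closed[OF s'(2)] core_subset unfolding y_def by auto
    have sy: "s \<in> N y" "s \<noteq> blocker y"
      using y N_sym s' blocker_notin by auto
    have "y \<notin> S"
      using S_far[OF s, of y] y N_irrefl unfolding far_def by blast
    \<comment> \<open>If \<open>y\<close> were in \<open>D\<close>, it would need load two from \<open>s\<close>, which omits it.\<close>
    have "y \<notin> D"
      using ordinary[of y] y \<open>y \<notin> S\<close> sy unfolding y_def by blast
    \<comment> \<open>The third neighbour of \<open>y\<close> is at distance two from \<open>s\<close>, so it is not in \<open>S\<close>; were it in
      \<open>D\<close>, closure would put \<open>y\<close> into \<open>D\<close>.\<close>
    have "partners y s \<inter> D = {}"
    proof (rule ccontr)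
      assume "partners y s \<inter> D \<noteq> {}"
      then obtain x where x: "x \<in> N y - {blocker y}" "x \<noteq> s" "x \<in> D"
        using omitted_undominated[OF y(3) \<open>y \<notin> S\<close>] unfolding partners_def
        by (auto split: if_splits)
      have "x \<in> undominated"
        using core_closed[OF y(2)] x core_subset by blast
      moreover have "x \<notin> S"
        using S_far[OF s, of x] x y N_sym unfolding far_def by blast
      moreover have "y \<in> N x - {blocker x}"
        using x y N_sym blocker_notin(2) \<open>x \<in> undominated\<close> by blast
      ultimately show False
        using ordinary[of x] x \<open>y \<notin> D\<close> by blast
    qed
    then have "load D s y = 0"
      using load_le[of y s D] y \<open>y \<notin> D\<close> by simp
    then have "(\<Sum>u\<in>N s - {blocker s}. load D s u) = (\<Sum>u\<in>N s - {blocker s} - {y}. load D s u)"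
      using y by (simp add: sum.remove)
    also have "\<dots> \<le> card (N s - {blocker s} - {y}) * 2"
      using sum_bounded_above[of "N s - {blocker s} - {y}" "load D s" 2] load_le_2 by simp
    also have "\<dots> \<le> 2"
      using rest[OF s'(1)] y by simp
    finally show False
      using heavy[OF \<open>s \<in> D\<close>] split[OF s'(1)] blocker_load[OF s'(1)] by (simp split: if_splits)
  qed
  \<comment> \<open>With \<open>S\<close> out of the way, closure holds everywhere.\<close>
  have closed: "N b - {blocker b} \<subseteq> D \<inter> undominated" "N b - {blocker b} \<noteq> {}"
    if "b \<in> D \<inter> undominated" for b
    using ordinary[of b] no_special that by blast+
  then have "D \<inter> undominated \<subseteq> core"
    by (intro core_greatest) auto
  moreover obtain b where b: "b \<in> D \<inter> undominated"
    using double \<open>D \<noteq> {}\<close> by blast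
  ultimately obtain t where t: "t \<in> S" "\<not> far b t" "b \<notin> S"
    using S_maximal[of b] no_special by blast
  have tU: "t \<in> undominated"
    using t S_core core_subset by blast
  consider "t \<in> N b" | x where "x \<in> N b" "x \<in> N t"
    using t unfolding far_def by blast
  then have "t \<in> D"
  proof cases
    case 1
    then show ?thesis
      using closed(1)[OF b] tU blocker_notin(2)[of b] b by blast
  next
    case 2
    \<comment> \<open>A blocker of \<open>b\<close> has no second undominated neighbour \<open>t\<close>.\<close>
    have "x \<noteq> blocker b"
      using blocker_unique[of b t] b tU 2 N_sym t by blast
    then have "x \<in> D \<inter> undominated"
      using closed(1)[OF b] 2 by blast
    then show ?thesis
      using closed(1)[of x] 2 N_sym tU blocker_notin(2)[of x] by blast
  qed
  then show False
    using no_special t by blast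
qed

text \<open>
  A monochromatic neighbourhood of three vertices is not contained in \<^term>\<open>A\<close> by sparsity, so it is
  disjoint from \<^term>\<open>A\<close>. Its centre is therefore in \<^term>\<open>A\<close> or undominated, and the two neighbours that
  the centre does not omit are in conflict.
\<close>

lemma five_coloring:
  "\<exists>c :: 'a \<Rightarrow> nat. (\<forall>v\<in>V. c v < 5) \<and> (\<forall>u\<in>V. \<forall>v\<in>N u. c u \<noteq> c v) \<and>
     (\<forall>v\<in>V. \<forall>i. card {u \<in> N v. c u = i} \<le> 2)"
proof -
  have "finite (V - A)"
    using finite_V by simp
  then obtain g :: "'a \<Rightarrow> nat" where g: "\<And>x. x \<in> V - A \<Longrightarrow> g x < 4"
      "\<And>x y. x \<in> V - A \<Longrightarrow> y \<in> V - A \<Longrightarrow> conflict x y \<Longrightarrow> g x \<noteq> g y"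
    using degenerate_coloring[of "V - A" conflict 4] conflict_sym conflict_irrefl
      conflict_degenerate by blast
  define c where "c v = (if v \<in> A then 0 else Suc (g v))" for v
  have "\<forall>v\<in>V. c v < 5"
    using g(1) unfolding c_def by fastforce
  moreover have "c u \<noteq> c v" if "u \<in> V" "v \<in> N u" for u v
  proof -
    have "v \<in> V" "conflict u v" "\<not> (u \<in> A \<and> v \<in> A)"
      using that N_subset A_independent unfolding conflict_def by auto
    then show ?thesis
      using g(2)[of u v] that unfolding c_def by auto
  qed
  moreover have "card {u \<in> N v. c u = i} \<le> 2" if "v \<in> V" for v i
  proof (rule ccontr)
    assume "\<not> ?thesis"
    then have big: "3 \<le> card {u \<in> N v. c u = i}"
      by simp
    have "{u \<in> N v. c u = i} = N v"
      using big N_card[of v] by (intro card_seteq) auto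
    then have mono: "c u = i" if "u \<in> N v" for u
      using that by blast
    have card3: "card (N v) = 3"
      using big N_card[of v] \<open>{u \<in> N v. c u = i} = N v\<close> by simp
    have "N v \<inter> A = {}"
    proof (rule ccontr)
      assume "N v \<inter> A \<noteq> {}"
      then have "i = 0"
        using mono unfolding c_def by force
      then have "N v \<inter> A = N v"
        using mono unfolding c_def by (metis Int_absorb2 nat.distinct(1) subsetI)
      then show False
        using A_two[of v] card3 by simp
    qed
    then have v: "v \<in> A \<union> undominated"
      using that unfolding undominated_def by blast
    have "omitted v \<in> N v"
      using omitted_in[of v] card3 by fastforce
    then have "card (N v - {omitted v}) = 2"
      using card3 by simp
    then obtain x y where xy: "N v - {omitted v} = {x, y}" "x \<noteq> y"
      by (auto simp: card_2_iff)
    have xyN: "x \<in> N v" "y \<in> N v" "x \<noteq> omitted v" "y \<noteq> omitted v"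
      using xy by blast+
    have "v \<in> N x" "y \<in> partners v x"
      using xyN xy(2) v N_sym unfolding partners_def by auto
    then have "conflict x y"
      unfolding conflict_def by blast
    moreover have "x \<in> V - A" "y \<in> V - A"
      using xyN N_subset \<open>N v \<inter> A = {}\<close> by blast+
    ultimately have "g x \<noteq> g y"
      using g(2) by blast
    moreover have "c x = c y"
      using mono xyN by simp
    ultimately show False
      using \<open>x \<in> V - A\<close> \<open>y \<in> V - A\<close> unfolding c_def by simp
  qed
  ultimately show ?thesis
    by blast
qed

end

context subcubic
begin

theorem two_frugal_five_coloring:
  "\<exists>c :: 'a \<Rightarrow> nat. (\<forall>v\<in>V. c v < 5) \<and> (\<forall>u\<in>V. \<forall>v\<in>N u. c u \<noteq> c v) \<and>
     (\<forall>v\<in>V. \<forall>i. card {u \<in> N v. c u = i} \<le> 2)"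
proof -
  have "sparse {}"
    unfolding sparse_def by simp
  then obtain A where "A \<subseteq> V" "sparse A" "\<And>Y. Y \<subseteq> V \<Longrightarrow> sparse Y \<Longrightarrow> A \<subseteq> Y \<Longrightarrow> Y = A"
    using finite_maximal_subset[OF finite_V, of "{}" sparse] by (metis empty_subsetI)
  then interpret maximal_sparse V N A
    by unfold_locales
  have "core \<subseteq> V"
    using core_subset unfolding undominated_def by blast
  then have "finite core"
    using finite_V by (rule finite_subset)
  then obtain S where S: "S \<subseteq> core" "\<forall>s\<in>S. \<forall>t\<in>S. s \<noteq> t \<longrightarrow> far s t"
    and max: "\<And>Y. Y \<subseteq> core \<Longrightarrow> \<forall>s\<in>Y. \<forall>t\<in>Y. s \<noteq> t \<longrightarrow> far s t \<Longrightarrow> S \<subseteq> Y \<Longrightarrow> Y = S"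
    using finite_maximal_subset[of core "{}" "\<lambda>S. \<forall>s\<in>S. \<forall>t\<in>S. s \<noteq> t \<longrightarrow> far s t"]
    by (metis empty_iff empty_subsetI)
  have "\<exists>t\<in>S. \<not> far b t" if b: "b \<in> core" "b \<notin> S" for b
  proof (rule ccontr)
    assume "\<not> ?thesis"
    then have "\<forall>s\<in>insert b S. \<forall>t\<in>insert b S. s \<noteq> t \<longrightarrow> far s t"
      using S far_sym by blast
    then show False
      using max[of "insert b S"] S b by blast
  qed
  then interpret scattered_core V N A S
    using S by unfold_locales auto
  show ?thesis
    by (rule five_coloring)
qed

end

section \<open>The frugal chromatic number of a subcubic graph\<close>

context graph
begin

lemma card_nbhd: "card (nbhd G v) = out_degree G v"
proof -
  have "nbhd G v = head G ` out_arcs G v"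
    unfolding nbhd_def by (auto simp: arcs_ends_conv in_out_arcs_conv image_iff)
  moreover have "inj_on (head G) (out_arcs G v)"
    using no_multi_arcs by (auto simp: inj_on_def arc_to_ends_def)
  ultimately show ?thesis
    by (simp add: card_image out_degree_def)
qed

lemma subcubic_nbhd:
  assumes "max_degree G \<le> 3"
  shows "subcubic (verts G) (nbhd G)"
proof
  show "finite (verts G)" by simp
  show "nbhd G v \<subseteq> verts G" for v
    unfolding nbhd_def by (auto dest: adj_in_verts)
  show "u \<in> nbhd G v \<Longrightarrow> v \<in> nbhd G u" for u v
    unfolding nbhd_def by (simp add: arcs_ends_symmetric[OF sym_arcs])
  show "v \<notin> nbhd G v" for v
    unfolding nbhd_def using adj_not_same by auto
  show "card (nbhd G v) \<le> 3" for v
  proof (cases "v \<in> verts G")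
    case True
    then have "out_degree G v \<le> max_degree G"
      unfolding max_degree_def by (intro cSUP_upper) simp_all
    then show ?thesis
      using assms by (simp add: card_nbhd)
  next
    case False
    then have "nbhd G v = {}"
      unfolding nbhd_def by (auto dest: adj_in_verts)
    then show ?thesis
      by simp
  qed
qed

lemma frugal_chromatic_number_le:
  fixes c :: "'a \<Rightarrow> nat"
  assumes "frugal_coloring t G c"
  shows "frugal_chromatic_number t G \<le> card (c ` verts G)"
  unfolding frugal_chromatic_number_def using assms by (blast intro: Least_le)

lemma two_frugal_upper:
  assumes "max_degree G \<le> 3"
  shows "frugal_chromatic_number 2 G \<le> 5"
proof -
  obtain c :: "'a \<Rightarrow> nat" where c: "\<forall>v\<in>verts G. c v < 5"
    "\<forall>u\<in>verts G. \<forall>v\<in>nbhd G u. c u \<noteq> c v"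
    "\<forall>v\<in>verts G. \<forall>i. card {u \<in> nbhd G v. c u = i} \<le> 2"
    using subcubic.two_frugal_five_coloring[OF subcubic_nbhd[OF assms]] by blast
  have "frugal_coloring 2 G c"
    using c adj_in_verts unfolding frugal_coloring_def proper_coloring_def nbhd_def by blast
  moreover have "card (c ` verts G) \<le> card {..<5::nat}"
    using c(1) by (intro card_mono) auto
  ultimately show ?thesis
    using frugal_chromatic_number_le by fastforce
qed

lemma two_frugal_lower:
  assumes "v \<in> verts G" "3 \<le> out_degree G v"
  shows "3 \<le> frugal_chromatic_number 2 G"
proof -
  obtain c :: "'a \<Rightarrow> nat" where c: "frugal_coloring 2 G c"
    and k: "card (c ` verts G) = frugal_chromatic_number 2 G"
    using frugal_chromatic_number_attained[of 2] by auto
  have N: "nbhd G v \<subseteq> verts G" "finite (nbhd G v)"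
    unfolding nbhd_def by (auto dest: adj_in_verts intro: finite_subset[OF _ finite_verts])
  have "2 \<le> card (c ` nbhd G v)"
  proof (rule ccontr)
    assume "\<not> ?thesis"
    then have "card (c ` nbhd G v) \<le> 1"
      by simp
    then obtain i where "c ` nbhd G v \<subseteq> {i}"
      using N(2) by (metis card_le_Suc0_iff_eq One_nat_def finite_imageI insertI1 subsetI)
    then have "{u \<in> nbhd G v. c u = i} = nbhd G v"
      by blast
    moreover have "card {u \<in> nbhd G v. c u = i} \<le> 2"
      using c assms(1) unfolding frugal_coloring_def by blast
    ultimately show False
      using assms(2) card_nbhd[of v] by simp
  qed
  moreover have "c v \<notin> c ` nbhd G v"
    using c unfolding frugal_coloring_def proper_coloring_def nbhd_def by auto
  then have "card (insert (c v) (c ` nbhd G v)) = Suc (card (c ` nbhd G v))"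
    using N(2) by simp
  moreover have "card (insert (c v) (c ` nbhd G v)) \<le> card (c ` verts G)"
    using N assms(1) by (intro card_mono) auto
  ultimately show ?thesis
    using k by simp
qed

lemma max_degree_attained:
  assumes "0 < max_degree G"
  shows "\<exists>v\<in>verts G. out_degree G v = max_degree G"
proof -
  have "verts G \<noteq> {}"
    using assms unfolding max_degree_def by auto
  then have "max_degree G \<in> out_degree G ` verts G"
    unfolding max_degree_def by (metis Max_in cSup_eq_Max finite_imageI finite_verts image_is_empty)
  then show ?thesis
    by (auto simp: image_iff)
qed

end

theorem theorem4p2:
  fixes G :: "('a, 'b) pre_digraph"
  assumes "graph G"
    and "max_degree G = 3"
  shows "3 \<le> frugal_chromatic_number 2 G \<and> frugal_chromatic_number 2 G \<le> 5"
proof -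
  interpret graph G
    by (fact assms(1))
  obtain v where "v \<in> verts G" "out_degree G v = 3"
    using max_degree_attained assms(2) by auto
  then show ?thesis
    using two_frugal_lower two_frugal_upper assms(2) by simp
qed

end
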